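(* Let $m\ge 1$ be an integer, $1\le p\le\infty$, and $0<r<\infty$. Assume that there is a constant $C>0$ such that every continuous $m$-linear operator $T\in\mathcal L({}^m\ell_1;\ell_p)$ satisfies $\pi_{\mathrm{as}(r;1)}(T)\le C\|T\|$. Then $r\ge r_{m,p}$, where $$r_{m,p}=\begin{cases}\dfrac{2p}{mp+2p-2}, & 1\le p\le 2,\\[8pt] \dfrac{2p}{mp+2}, & 2\le p\le\infty,\end{cases}$$ and for $p=\infty$ the second expression is understood as $r_{m,\infty}=2/m$.
   Context: All Banach spaces are over a fixed field $\mathbb K\in\{\mathbb R,\mathbb C\}$. $\mathcal L({}^mE;F)$ denotes the space of continuous $m$-linear maps $E\times\cdots\times E\to F$ with the usual operator norm $\|T\|$. The weak $1$-norm of a finite family $(x_j)_{j=1}^N$ in a Banach space $E$ is $\|(x_j)_{j=1}^N\|_{w,1}=\sup_{\varphi\in B_{E^*}}\sum_{j=1}^N|\varphi(x_j)|$, where $B_{E^*}$ is the closed unit ball of the dual. For $0<r<\infty$, an operator $T\in\mathcal L({}^mE;F)$ is absolutely $(r;1)$-summing if there is $C\ge0$ such that $$\Bigl(\sum_{j=1}^N\|T(x_j^{(1)},\ldots,x_j^{(m)})\|^r\Bigr)^{1/r}\le C\prod_{q=1}^m\|(x_j^{(q)})_{j=1}^N\|_{w,1}$$ for every $N\in\mathbb N$ and all finite families $(x_j^{(q)})_{j=1}^N\subset E$, $1\le q\le m$. The least such $C$ is denoted $\pi_{\mathrm{as}(r;1)}(T)$ (with $\pi_{\mathrm{as}(r;1)}(T)=\infty$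 if no such $C$ exists, so that the inequality $\pi_{\mathrm{as}(r;1)}(T)\le C\|T\|$ includes the assertion that $T$ is absolutely $(r;1)$-summing). *)

theory Defs
  imports "HOL-Analysis.Analysis" "HOL-Library.Function_Algebras"
begin

text \<open>
  The spaces \<open>\<ell>\<^sub>p\<close> depend on a value \<open>p\<close>, so they cannot be types. A normed space is
  represented by a carrier inside an abelian group type, a scalar multiplication and a norm.
  The normed space axioms are not part of the record; they hold for the spaces \<open>\<ell>\<^sub>p\<close>, \<open>1 \<le> p\<close>.
\<close>

record ('k, 'v) nspace =
  pts :: "'v set"
  scale :: "'k \<Rightarrow> 'v \<Rightarrow> 'v"
  nrm :: "'v \<Rightarrow> real"

text \<open>The case distinction is there because \<open>Metric_space\<close> requires the distance to be
  nonnegative and symmetric off the carrier as well.\<close>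

definition norm_topology :: "('k, 'v::ab_group_add) nspace \<Rightarrow> 'v topology" where
  "norm_topology E =
     Metric_space.mtopology (pts E)
       (\<lambda>x y. if x \<in> pts E \<and> y \<in> pts E then nrm E (x - y) else 0)"

definition unit_ball :: "('k, 'v) nspace \<Rightarrow> 'v set" where
  "unit_ball E = {x \<in> pts E. nrm E x \<le> 1}"

text \<open>An \<open>m\<close>-tuple is an extensional function on \<open>{..<m}\<close>.\<close>

definition multilinear_on ::
  "nat \<Rightarrow> ('k, 'v::ab_group_add) nspace \<Rightarrow> ('k, 'w::ab_group_add) nspace
    \<Rightarrow> ((nat \<Rightarrow> 'v) \<Rightarrow> 'w) \<Rightarrow> bool" where
  "multilinear_on m E F T \<longleftrightarrow>
     (\<forall>x \<in> {..<m} \<rightarrow>\<^sub>E pts E. \<forall>i<m.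
        (\<forall>u\<in>pts E. \<forall>v\<in>pts E. T (x(i := u + v)) = T (x(i := u)) + T (x(i := v))) \<and>
        (\<forall>a. \<forall>u\<in>pts E. T (x(i := scale E a u)) = scale F a (T (x(i := u)))))"

definition multilinear_operators ::
  "nat \<Rightarrow> ('k, 'v::ab_group_add) nspace \<Rightarrow> ('k, 'w::ab_group_add) nspace
    \<Rightarrow> ((nat \<Rightarrow> 'v) \<Rightarrow> 'w) set" where
  "multilinear_operators m E F =
     {T. multilinear_on m E F T \<and>
         continuous_map (product_topology (\<lambda>_. norm_topology E) {..<m}) (norm_topology F) T}"

definition op_norm ::
  "nat \<Rightarrow> ('k, 'v) nspace \<Rightarrow> ('k, 'w) nspace \<Rightarrow> ((nat \<Rightarrow> 'v) \<Rightarrow> 'w) \<Rightarrow> real" where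
  "op_norm m E F T = (SUP x \<in> {..<m} \<rightarrow>\<^sub>E unit_ball E. nrm F (T x))"

definition dual_space ::
  "('k::real_normed_field, 'v::ab_group_add) nspace \<Rightarrow> ('v \<Rightarrow> 'k) set" where
  "dual_space E =
     {f. (\<forall>x\<in>pts E. \<forall>y\<in>pts E. f (x + y) = f x + f y) \<and>
         (\<forall>a. \<forall>x\<in>pts E. f (scale E a x) = a * f x) \<and>
         continuous_map (norm_topology E) euclidean f}"

definition dual_norm ::
  "('k::real_normed_field, 'v) nspace \<Rightarrow> ('v \<Rightarrow> 'k) \<Rightarrow> real" where
  "dual_norm E f = (SUP x \<in> unit_ball E. norm (f x))"

definition dual_ball ::
  "('k::real_normed_field, 'v::ab_group_add) nspace \<Rightarrow> ('v \<Rightarrow> 'k) set" where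
  "dual_ball E = {f \<in> dual_space E. dual_norm E f \<le> 1}"

definition weak1_norm ::
  "('k::real_normed_field, 'v::ab_group_add) nspace \<Rightarrow> nat \<Rightarrow> (nat \<Rightarrow> 'v) \<Rightarrow> real" where
  "weak1_norm E N x = (SUP f \<in> dual_ball E. \<Sum>j<N. norm (f (x j)))"

definition summing_bound ::
  "nat \<Rightarrow> real \<Rightarrow> ('k::real_normed_field, 'v::ab_group_add) nspace \<Rightarrow> ('k, 'w) nspace
    \<Rightarrow> ((nat \<Rightarrow> 'v) \<Rightarrow> 'w) \<Rightarrow> real \<Rightarrow> bool" where
  "summing_bound m r E F T C \<longleftrightarrow>
     (\<forall>N. \<forall>x :: nat \<Rightarrow> nat \<Rightarrow> 'v. (\<forall>q<m. \<forall>j<N. x q j \<in> pts E) \<longrightarrow>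
        (\<Sum>j<N. nrm F (T (\<lambda>q\<in>{..<m}. x q j)) powr r) powr (1 / r)
          \<le> C * (\<Prod>q<m. weak1_norm E N (x q)))"

text \<open>The infimum is attained when the set is nonempty, and \<open>Inf {} = \<infinity>\<close> otherwise.\<close>

definition pi_as ::
  "nat \<Rightarrow> real \<Rightarrow> ('k::real_normed_field, 'v::ab_group_add) nspace \<Rightarrow> ('k, 'w) nspace
    \<Rightarrow> ((nat \<Rightarrow> 'v) \<Rightarrow> 'w) \<Rightarrow> ennreal" where
  "pi_as m r E F T = Inf (ennreal ` {C. 0 \<le> C \<and> summing_bound m r E F T C})"

definition lp :: "ennreal \<Rightarrow> ('k::real_normed_field, nat \<Rightarrow> 'k) nspace" where
  "lp p =
     \<lparr> pts = (if p = \<infinity> then {x. bounded (range x)}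
              else {x. summable (\<lambda>n. norm (x n) powr enn2real p)}),
       scale = (\<lambda>a x n. a * x n),
       nrm = (\<lambda>x. if p = \<infinity> then (SUP n. norm (x n))
                   else (\<Sum>n. norm (x n) powr enn2real p) powr (1 / enn2real p)) \<rparr>"

definition critical_exponent :: "nat \<Rightarrow> ennreal \<Rightarrow> real" where
  "critical_exponent m p =
     (if p = \<infinity> then 2 / real m
      else let s = enn2real p in
        if s \<le> 2 then 2 * s / (real m * s + 2 * s - 2)
        else 2 * s / (real m * s + 2))"

end

theory Submission
  imports Defs
begin

text \<open>Let \<open>n = 2 ^ d\<close>. The characters \<open>x\<^sub>1, \<dots>, x\<^sub>n\<close> of \<open>(\<int>/2)\<^sup>d\<close> (Walsh functions), seen as vectors of
  \<open>\<ell>\<^sub>1\<close>, have weak \<open>1\<close>-norm at most \<open>n\<^bsup>3/2\<^esup>\<close> by Cauchy-Schwarz and Parseval's identity. The convolution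
  of \<open>m\<close> sequences over \<open>(\<int>/2)\<^sup>d\<close> has norm at most \<open>1\<close> as an operator into \<open>\<ell>\<^sub>p\<close> and maps \<open>(x\<^sub>j, \<dots>, x\<^sub>j)\<close>
  to \<open>n\<^bsup>m-1\<^esup> x\<^sub>j\<close>, whose norm is \<open>n\<^bsup>m-1+1/p\<^esup>\<close>. Its Fourier transform, the pointwise product of the
  transforms, has norm at most \<open>n\<^bsup>1/p\<^esup>\<close> and maps \<open>(x\<^sub>j, \<dots>, x\<^sub>j)\<close> to \<open>n\<^sup>m\<close> times a unit vector. Letting
  \<open>d\<close> grow, the first operator gives \<open>1/r \<le> m/2 + 1 - 1/p\<close> and the second \<open>1/r \<le> m/2 + 1/p\<close>. The
  characters being real, both scalar fields are treated at once.\<close>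

unbundle bit_operations_syntax

section \<open>Walsh functions\<close>

text \<open>Elements of the group and of its dual are both coded by the numbers below
  \<open>2 ^ d\<close>, read as bit vectors with \<open>XOR\<close> as addition. The value is (-1)
  to the number of positions below \<open>d\<close> where both bits are set.\<close>

definition walsh :: "nat \<Rightarrow> nat \<Rightarrow> nat \<Rightarrow> real" where
  "walsh d j k = (\<Prod>i<d. if bit j i \<and> bit k i then -1 else 1)"

lemma walsh_commute: "walsh d j k = walsh d k j"
  by (simp add: walsh_def conj_commute)

lemma walsh_xor: "walsh d j (k XOR l) = walsh d j k * walsh d j l"
  unfolding walsh_def prod.distrib[symmetric]
  by (intro prod.cong) (auto simp: bit_xor_iff)

lemma walsh_xor_left: "walsh d (j XOR k) l = walsh d j l * walsh d k l"
  by (metis walsh_commute walsh_xor)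

lemma walsh_0 [simp]: "walsh d 0 k = 1" "walsh d k 0 = 1"
  by (simp_all add: walsh_def)

lemma abs_walsh [simp]: "\<bar>walsh d j k\<bar> = 1"
  unfolding walsh_def abs_prod by (intro prod.neutral) auto

lemma xor_less_power2:
  fixes j k :: nat
  assumes "j < 2 ^ d" "k < 2 ^ d"
  shows "j XOR k < 2 ^ d"
  using assms by (metis take_bit_nat_eq_self take_bit_nat_less_exp take_bit_xor)

lemma bij_betw_xor:
  fixes k :: nat
  assumes "k < 2 ^ d"
  shows "bij_betw (\<lambda>j. j XOR k) {..<2 ^ d} {..<2 ^ d}"
  by (rule bij_betw_byWitness[where f' = "\<lambda>j. j XOR k"])
    (auto simp: xor.assoc xor_less_power2 assms)

lemma xor_eq_0_iff_nat: "j XOR k = 0 \<longleftrightarrow> j = (k::nat)"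
  by (metis xor.left_neutral xor.right_neutral xor_self_eq xor.assoc)

text \<open>A nontrivial character has sum zero: if bit \<open>i\<close> of \<open>k\<close> is set,
  then translation by \<open>2 ^ i\<close> permutes the group and flips the sign of every
  summand.\<close>

lemma sum_walsh:
  assumes "k < 2 ^ d"
  shows "(\<Sum>j<2 ^ d. walsh d j k) = (if k = 0 then 2 ^ d else 0)"
proof (cases "k = 0")
  case False
  then obtain i where i: "bit k i"
    using bit_eq_iff[of k 0] by auto
  have "i < d"
  proof (rule ccontr)
    assume "\<not> i < d"
    then have "k < 2 ^ i"
      using assms by (meson le_less_trans leI less_le_trans one_le_numeral power_increasing)
    then show False using i by (simp add: bit_iff_odd)
  qed
  then have lt: "(2::nat) ^ i < 2 ^ d" by simp
  have w: "walsh d (2 ^ i) k = -1"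
  proof -
    have "walsh d (2 ^ i) k = (\<Prod>l<d. if l = i then -1 else 1)"
      unfolding walsh_def using i by (intro prod.cong) (auto simp: bit_exp_iff)
    also have "\<dots> = -1" using \<open>i < d\<close> by simp
    finally show ?thesis .
  qed
  have "(\<Sum>j<2 ^ d. walsh d j k) = (\<Sum>j<2 ^ d. walsh d (j XOR 2 ^ i) k)"
    by (rule sum.reindex_bij_betw[OF bij_betw_xor[OF lt], symmetric])
  also have "\<dots> = - (\<Sum>j<2 ^ d. walsh d j k)"
    by (simp add: walsh_xor_left w sum_negf)
  finally show ?thesis using False by simp
qed simp

text \<open>The product of two characters is the character of \<open>k XOR l\<close>, which is
  trivial exactly if \<open>k = l\<close>.\<close>

lemma walsh_orthogonal:
  assumes "k < 2 ^ d" "l < 2 ^ d"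
  shows "(\<Sum>j<2 ^ d. walsh d j k * walsh d j l) = (if k = l then 2 ^ d else 0)"
  using sum_walsh[of "k XOR l" d] assms
  by (simp add: walsh_xor[symmetric] xor_less_power2 xor_eq_0_iff_nat)

section \<open>The Walsh transform, Parseval's identity and the test operators\<close>

definition walsh_transform :: "nat \<Rightarrow> (nat \<Rightarrow> 'k::real_vector) \<Rightarrow> nat \<Rightarrow> 'k" where
  "walsh_transform d x j = (\<Sum>k<2 ^ d. walsh d j k *\<^sub>R x k)"

lemma norm_walsh_transform_le:
  fixes x :: "nat \<Rightarrow> 'k::real_normed_vector"
  shows "norm (walsh_transform d x j) \<le> (\<Sum>k<2 ^ d. norm (x k))"
  unfolding walsh_transform_def by (rule order_trans[OF norm_sum]) simp

text \<open>Expanding the squares leaves, after interchanging the sums, only the diagonal terms by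
  orthogonality. The class \<open>real_inner\<close> contains both \<open>real\<close> and
  \<open>complex\<close>, whose norms come from a real inner product.\<close>

lemma parseval_walsh:
  fixes x :: "nat \<Rightarrow> 'k::real_inner"
  shows "(\<Sum>j<2 ^ d. (norm (walsh_transform d x j))\<^sup>2) = 2 ^ d * (\<Sum>k<2 ^ d. (norm (x k))\<^sup>2)"
proof -
  have "(\<Sum>j<2 ^ d. (norm (walsh_transform d x j))\<^sup>2)
      = (\<Sum>j<2 ^ d. \<Sum>k<2 ^ d. \<Sum>l<2 ^ d. walsh d j k * walsh d j l * (x l \<bullet> x k))"
    by (simp add: power2_norm_eq_inner walsh_transform_def inner_sum_left inner_sum_right
        sum_distrib_left mult.assoc mult.left_commute)
  also have "\<dots> = (\<Sum>k<2 ^ d. \<Sum>l<2 ^ d. \<Sum>j<2 ^ d. walsh d j k * walsh d j l * (x l \<bullet> x k))"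
    by (subst sum.swap) (intro sum.cong refl sum.swap)
  also have "\<dots> = (\<Sum>k<2 ^ d. \<Sum>l<2 ^ d. if k = l then 2 ^ d * (x l \<bullet> x k) else 0)"
    by (intro sum.cong refl) (simp add: sum_distrib_right[symmetric] walsh_orthogonal)
  also have "\<dots> = 2 ^ d * (\<Sum>k<2 ^ d. (norm (x k))\<^sup>2)"
    by (simp add: power2_norm_eq_inner sum_distrib_left)
  finally show ?thesis .
qed

text \<open>Cauchy-Schwarz against the constant 1 costs one factor \<open>2 ^ d\<close>, Parseval a
  second one, and the bounded coefficients contribute the third; the exponent 3/2 is the square root
  of this cube.\<close>

lemma sum_norm_walsh_transform_le:
  fixes x :: "nat \<Rightarrow> 'k::real_inner"
  assumes "\<And>k. k < 2 ^ d \<Longrightarrow> norm (x k) \<le> 1"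
  shows "(\<Sum>j<2 ^ d. norm (walsh_transform d x j)) \<le> (2 ^ d) powr (3/2)"
proof -
  have "(\<Sum>k<2 ^ d. (norm (x k))\<^sup>2) \<le> (\<Sum>k<(2::nat) ^ d. 1)"
    by (intro sum_mono) (simp add: assms power_le_one)
  then have le: "(\<Sum>k<2 ^ d. (norm (x k))\<^sup>2) \<le> 2 ^ d" by simp
  have "(\<Sum>j<2 ^ d. norm (walsh_transform d x j))\<^sup>2
      \<le> (\<Sum>j<2 ^ d. (norm (walsh_transform d x j))\<^sup>2) * (\<Sum>j<(2::nat)^d. 1\<^sup>2)"
    using Cauchy_Schwarz_ineq_sum[of "\<lambda>j. norm (walsh_transform d x j)" "\<lambda>_. 1" "{..<2 ^ d}"] by simp
  also have "\<dots> = 2 ^ d * (\<Sum>k<2 ^ d. (norm (x k))\<^sup>2) * 2 ^ d"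
    by (simp add: parseval_walsh)
  also have "\<dots> \<le> 2 ^ d * 2 ^ d * 2 ^ d"
    using le by simp
  also have "\<dots> = ((2 ^ d) powr (3/2))\<^sup>2"
    by (simp add: powr_power powr_numeral flip: power_add power_mult) 
  finally show ?thesis
    by (rule power2_le_imp_le) simp
qed

text \<open>Convolution over the group \<open>(\<int>/2)\<^sup>d\<close>, written on the Fourier side, where multilinearity is
  immediate, is the case \<open>c j s = walsh d j s / 2 ^ d\<close>; the case of the identity matrix \<open>c\<close> is the
  product of the transforms.\<close>

definition fourier_op ::
  "nat \<Rightarrow> nat \<Rightarrow> (nat \<Rightarrow> nat \<Rightarrow> real) \<Rightarrow> (nat \<Rightarrow> nat \<Rightarrow> 'k::real_normed_field) \<Rightarrow> nat \<Rightarrow> 'k" where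
  "fourier_op d m c x s =
     (if s < 2 ^ d then \<Sum>j<2 ^ d. c j s *\<^sub>R (\<Prod>q<m. walsh_transform d (x q) j) else 0)"

definition character :: "nat \<Rightarrow> nat \<Rightarrow> nat \<Rightarrow> 'k::real_normed_field" where
  "character d j k = (if k < 2 ^ d then of_real (walsh d j k) else 0)"

lemma walsh_transform_character:
  assumes "i < 2 ^ d" "j < 2 ^ d"
  shows "walsh_transform d (character d j :: nat \<Rightarrow> 'k::real_normed_field) i = (if i = j then 2 ^ d else 0)"
proof -
  have "walsh_transform d (character d j :: nat \<Rightarrow> 'k) i
      = of_real (\<Sum>k<2 ^ d. walsh d k i * walsh d k j)"
    by (simp add: walsh_transform_def character_def scaleR_conv_of_real walsh_commute)
  then show ?thesis by (simp add: walsh_orthogonal assms)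
qed

text \<open>By orthogonality the transform of a character is \<open>2 ^ d\<close> times a unit
  vector, so only the summand \<open>i = j\<close> survives. For \<open>m = 0\<close> the empty
  product would not vanish at the other indices.\<close>

lemma fourier_op_character:
  assumes "j < 2 ^ d" "s < 2 ^ d" "0 < m" "\<And>q. q < m \<Longrightarrow> x q = character d j"
  shows "fourier_op d m c x s = of_real (c j s * (2 ^ d) ^ m :: real)"
proof -
  have "fourier_op d m c x s = (\<Sum>i<2 ^ d. c i s *\<^sub>R (\<Prod>q<m. walsh_transform d (character d j) i))"
    using assms(2,4) by (simp add: fourier_op_def)
  also have "\<dots> = (\<Sum>i<2 ^ d. if i = j then c j s *\<^sub>R (2 ^ d) ^ m else 0)"
    using assms(1,3) by (intro sum.cong refl) (simp add: walsh_transform_character)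
  finally have "fourier_op d m c x s = (\<Sum>i<2 ^ d. if i = j then c j s *\<^sub>R (2 ^ d) ^ m else 0)" .
  then show ?thesis using assms(1) by (simp add: scaleR_conv_of_real)
qed

text \<open>Young's inequality for the l_1 norm, by induction on the number of factors. The empty
  convolution is the unit mass at 0, since the transform of that mass is constantly 1.\<close>

lemma sum_norm_convolution_le:
  fixes x :: "nat \<Rightarrow> nat \<Rightarrow> 'k::real_normed_field"
  shows "(\<Sum>s<2 ^ d. norm (fourier_op d m (\<lambda>j s. walsh d j s / 2 ^ d) x s))
    \<le> (\<Prod>q<m. \<Sum>k<2 ^ d. norm (x q k))"
proof (induction m)
  case 0
  have "norm (fourier_op d 0 (\<lambda>j s. walsh d j s / 2 ^ d) x s) = (if s = 0 then 1 else 0)"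
    if "s < 2 ^ d" for s
  proof -
    have "fourier_op d 0 (\<lambda>j s. walsh d j s / 2 ^ d) x s
        = of_real ((\<Sum>j<2 ^ d. walsh d j s) / 2 ^ d)"
      using that by (simp add: fourier_op_def scaleR_conv_of_real sum_divide_distrib)
    then show ?thesis using that by (simp add: sum_walsh)
  qed
  then show ?case by simp
next
  case (Suc m)
  let ?T = "\<lambda>m. fourier_op d m (\<lambda>j s. walsh d j s / 2 ^ d) x"
  \<comment> \<open>One more factor in the product of transforms is one more convolution, because
    \<open>walsh d j s * walsh d j k = walsh d j (s XOR k)\<close>.\<close>
  have rec: "?T (Suc m) s = (\<Sum>k<2 ^ d. x m k * ?T m (s XOR k))" if "s < 2 ^ d" for s
  proof -
    have "?T (Suc m) s = (\<Sum>j<2 ^ d. \<Sum>k<2 ^ d.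
        (walsh d j (s XOR k) / 2 ^ d) *\<^sub>R (x m k * (\<Prod>q<m. walsh_transform d (x q) j)))"
      using that
      by (simp add: fourier_op_def walsh_transform_def[of d "x m"] sum_distrib_left walsh_xor
          scaleR_right.sum sum_divide_distrib mult_ac)
    also have "\<dots> = (\<Sum>k<2 ^ d. x m k * ?T m (s XOR k))"
      by (subst sum.swap) (simp add: fourier_op_def xor_less_power2 that sum_distrib_left)
    finally show ?thesis .
  qed
  have "(\<Sum>s<2 ^ d. norm (?T (Suc m) s)) \<le> (\<Sum>s<2 ^ d. \<Sum>k<2 ^ d. norm (x m k) * norm (?T m (s XOR k)))"
    by (intro sum_mono) (simp add: rec, intro sum_norm_le, simp add: norm_mult)
  also have "\<dots> = (\<Sum>k<2 ^ d. norm (x m k) * (\<Sum>s<2 ^ d. norm (?T m (s XOR k))))"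
    by (subst sum.swap) (simp add: sum_distrib_left)
  \<comment> \<open>The l_1 norm is invariant under the translation by \<open>k\<close>.\<close>
  also have "\<dots> = (\<Sum>k<2 ^ d. norm (x m k) * (\<Sum>s<2 ^ d. norm (?T m s)))"
    by (intro sum.cong refl) (simp add: sum.reindex_bij_betw[OF bij_betw_xor, of _ d "\<lambda>s. norm (?T m s)"])
  also have "\<dots> \<le> (\<Prod>q<Suc m. \<Sum>k<2 ^ d. norm (x q k))"
    using mult_right_mono[OF Suc, of "\<Sum>k<2 ^ d. norm (x m k)"]
    by (simp add: sum_distrib_right[symmetric] sum_nonneg mult.commute)
  finally show ?case .
qed

text \<open>The identity matrix selects the value at \<open>s\<close> of the product of the
  transforms, and each transform is bounded by the l_1 norm.\<close>

lemma norm_transform_product_le: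
  fixes x :: "nat \<Rightarrow> nat \<Rightarrow> 'k::real_normed_field"
  shows "norm (fourier_op d m (\<lambda>j s. of_bool (j = s)) x s) \<le> (\<Prod>q<m. \<Sum>k<2 ^ d. norm (x q k))"
proof (cases "s < 2 ^ d")
  case True
  have "(\<Sum>j<2 ^ d. of_bool (j = s) *\<^sub>R (\<Prod>q<m. walsh_transform d (x q) j))
      = (\<Sum>j<2 ^ d. if j = s then \<Prod>q<m. walsh_transform d (x q) j else 0)"
    by (intro sum.cong refl) simp
  then have "fourier_op d m (\<lambda>j s. of_bool (j = s)) x s = (\<Prod>q<m. walsh_transform d (x q) s)"
    using True by (simp add: fourier_op_def)
  then show ?thesis
    by (simp add: prod_norm[symmetric]) (intro prod_mono, simp add: norm_walsh_transform_le)
qed (simp add: fourier_op_def prod_nonneg sum_nonneg)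

section \<open>The spaces \<open>\<ell>\<^sub>p\<close>\<close>

text \<open>Convexity of the power function on the positive reals, extended to the boundary: if
  \<open>u\<close> or \<open>v\<close> is 0, the claim reduces to \<open>t powr s \<le> t\<close>
  for \<open>0 < t \<le> 1\<close>.\<close>

lemma powr_convex_combination_le:
  fixes u v l \<mu> s :: real
  assumes "0 \<le> u" "0 \<le> v" "0 < l" "0 < \<mu>" "l + \<mu> = 1" "1 \<le> s"
  shows "(l * u + \<mu> * v) powr s \<le> l * u powr s + \<mu> * v powr s"
proof -
  have shrink: "(t * w) powr s \<le> t * w powr s" if "0 < t" "t \<le> 1" "0 \<le> w" for t w :: real
  proof -
    have "t powr s \<le> t powr 1" using that \<open>1 \<le> s\<close> by (intro powr_mono') auto
    then show ?thesis using that by (simp add: powr_mult mult_right_mono)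
  qed
  show ?thesis
  proof (cases "u = 0 \<or> v = 0")
    case True
    then show ?thesis using assms shrink[of \<mu> v] shrink[of l u] by auto
  next
    case False
    moreover have "l = 1 - \<mu>" using assms(5) by simp
    ultimately show ?thesis
      using convex_onD[OF powr_convex[OF \<open>1 \<le> s\<close>], of \<mu> u v] False assms(1-4) by simp
  qed
qed

text \<open>If \<open>a\<close> and \<open>b\<close> are the two norms, then
  \<open>(x + y) / (a + b)\<close> is a convex combination of the normalised sequences
  \<open>x / a\<close> and \<open>y / b\<close>; convexity of the power is applied in each term. If
  one norm is 0, that sequence vanishes.\<close>

lemma minkowski_suminf:
  fixes x y :: "nat \<Rightarrow> 'a::real_normed_vector"
  assumes "1 \<le> s"
    and x: "summable (\<lambda>n. norm (x n) powr s)" and y: "summable (\<lambda>n. norm (y n) powr s)"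
  shows "summable (\<lambda>n. norm (x n + y n) powr s)" (is ?S)
    and "(\<Sum>n. norm (x n + y n) powr s) powr (1 / s)
      \<le> (\<Sum>n. norm (x n) powr s) powr (1 / s) + (\<Sum>n. norm (y n) powr s) powr (1 / s)" (is ?I)
proof -
  define A where "A = (\<Sum>n. norm (x n) powr s)"
  define B where "B = (\<Sum>n. norm (y n) powr s)"
  have AB: "0 \<le> A" "0 \<le> B" unfolding A_def B_def by (auto intro: suminf_nonneg x y)
  have "?S \<and> ?I"
  proof (cases "A = 0 \<or> B = 0")
    case True
    then consider "\<And>n. x n = 0" | "\<And>n. y n = 0"
      unfolding A_def B_def using suminf_eq_zero_iff[OF x] suminf_eq_zero_iff[OF y] by auto
    then show ?thesis by cases (use x y in auto)
  next
    case False
    define a where "a = A powr (1 / s)"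
    define b where "b = B powr (1 / s)"
    have ab: "0 < a" "0 < b" using False AB by (auto simp: a_def b_def)
    have pw: "a powr s = A" "b powr s = B" using AB \<open>1 \<le> s\<close> by (auto simp: a_def b_def powr_powr)
    \<comment> \<open>The termwise majorant given by convexity. Both normalised series sum to 1 and
      the weights add up to 1, so \<open>h\<close> sums to \<open>(a + b) powr s\<close>.\<close>
    define h where "h = (\<lambda>n. (a + b) powr s *
      (a / (a + b) * (norm (x n) powr s / A) + b / (a + b) * (norm (y n) powr s / B)))"
    have le: "norm (x n + y n) powr s \<le> h n" for n
    proof -
      have "norm (x n + y n) \<le> (a + b) * (a / (a + b) * (norm (x n) / a) + b / (a + b) * (norm (y n) / b))"
        using ab norm_triangle_ineq[of "x n" "y n"] by (simp add: distrib_left)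
      then have "norm (x n + y n) powr s
          \<le> ((a + b) * (a / (a + b) * (norm (x n) / a) + b / (a + b) * (norm (y n) / b))) powr s"
        using \<open>1 \<le> s\<close> by (intro powr_mono2) auto
      also have "\<dots> = (a + b) powr s * (a / (a + b) * (norm (x n) / a) + b / (a + b) * (norm (y n) / b)) powr s"
        by (rule powr_mult)
      also have "\<dots> \<le> (a + b) powr s * (a / (a + b) * (norm (x n) / a) powr s + b / (a + b) * (norm (y n) / b) powr s)"
        using ab \<open>1 \<le> s\<close>
        by (intro mult_left_mono powr_convex_combination_le) (auto simp: add_divide_distrib[symmetric])
      also have "\<dots> = h n"
        using ab by (simp add: h_def powr_divide pw)
      finally show ?thesis .
    qed
    have "(\<lambda>n. norm (x n) powr s / A) sums 1"
      using sums_divide[OF summable_sums[OF x], of A] False by (simp add: A_def)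
    moreover have "(\<lambda>n. norm (y n) powr s / B) sums 1"
      using sums_divide[OF summable_sums[OF y], of B] False by (simp add: B_def)
    ultimately have "h sums ((a + b) powr s * (a / (a + b) * 1 + b / (a + b) * 1))"
      unfolding h_def by (intro sums_mult sums_add)
    moreover have "a / (a + b) * 1 + b / (a + b) * 1 = 1"
      using ab by (simp add: add_divide_distrib[symmetric])
    ultimately have h: "h sums ((a + b) powr s)"
      by simp
    have S: ?S
      by (rule summable_comparison_test'[OF sums_summable[OF h], of 0]) (simp add: le)
    have "(\<Sum>n. norm (x n + y n) powr s) \<le> (a + b) powr s"
      using suminf_le[OF le S sums_summable[OF h]] sums_unique[OF h] by simp
    then have "(\<Sum>n. norm (x n + y n) powr s) powr (1 / s) \<le> ((a + b) powr s) powr (1 / s)"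
      using \<open>1 \<le> s\<close> by (intro powr_mono2 suminf_nonneg S) auto
    also have "\<dots> = a + b" using ab \<open>1 \<le> s\<close> by (simp add: powr_powr)
    finally show ?thesis using S by (simp add: a_def b_def A_def B_def)
  qed
  then show ?S ?I by blast+
qed

section \<open>Norm and metric of the sequence spaces\<close>

lemma enn2real_ge_1:
  assumes "1 \<le> p" "p \<noteq> \<infinity>"
  shows "1 \<le> enn2real p"
  using assms enn2real_mono[of 1 p] by (simp add: top.not_eq_extremum)

lemma bdd_above_norm_lp_infinity:
  fixes x :: "nat \<Rightarrow> 'k::real_normed_field"
  assumes "x \<in> pts (lp \<infinity> :: ('k, _) nspace)"
  shows "bdd_above (range (\<lambda>n. norm (x n)))"
  using assms bdd_above_norm[of "range x"] by (simp add: lp_def image_image)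

lemma lp_add:
  fixes x y :: "nat \<Rightarrow> 'k::real_normed_field"
  assumes "1 \<le> p" "x \<in> pts (lp p :: ('k, _) nspace)" "y \<in> pts (lp p :: ('k, _) nspace)"
  shows "x + y \<in> pts (lp p :: ('k, _) nspace)"
    and "nrm (lp p :: ('k, _) nspace) (x + y) \<le> nrm (lp p :: ('k, _) nspace) x + nrm (lp p :: ('k, _) nspace) y"
proof -
  have "x + y \<in> pts (lp p :: ('k, _) nspace) \<and>
    nrm (lp p :: ('k, _) nspace) (x + y) \<le> nrm (lp p :: ('k, _) nspace) x + nrm (lp p :: ('k, _) nspace) y"
  proof (cases "p = \<infinity>")
    case True
    have bdd: "bdd_above (range (\<lambda>n. norm (x n)))" "bdd_above (range (\<lambda>n. norm (y n)))"
      using assms(2,3) by (auto intro!: bdd_above_norm_lp_infinity simp: True)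
    have "norm (x n + y n) \<le> (SUP n. norm (x n)) + (SUP n. norm (y n))" for n
      by (intro order_trans[OF norm_triangle_ineq] add_mono cSUP_upper bdd) auto
    then show ?thesis
      unfolding lp_def using True by (auto simp: bounded_iff intro!: cSUP_least)
  next
    case False
    show ?thesis
      using minkowski_suminf[OF enn2real_ge_1[OF assms(1) False], of x y] assms(2,3) False
      by (simp add: lp_def)
  qed
  then show "x + y \<in> pts (lp p :: ('k, _) nspace)"
    and "nrm (lp p :: ('k, _) nspace) (x + y) \<le> nrm (lp p :: ('k, _) nspace) x + nrm (lp p :: ('k, _) nspace) y"
    by blast+
qed

lemma lp_minus:
  fixes x :: "nat \<Rightarrow> 'k::real_normed_field"
  shows "- x \<in> pts (lp p :: ('k, _) nspace) \<longleftrightarrow> x \<in> pts (lp p :: ('k, _) nspace)"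
    and "nrm (lp p :: ('k, _) nspace) (- x) = nrm (lp p :: ('k, _) nspace) x"
  by (simp_all add: lp_def bounded_iff)

lemma lp_diff:
  fixes x y :: "nat \<Rightarrow> 'k::real_normed_field"
  assumes "1 \<le> p" "x \<in> pts (lp p :: ('k, _) nspace)" "y \<in> pts (lp p :: ('k, _) nspace)"
  shows "x - y \<in> pts (lp p :: ('k, _) nspace)"
  using lp_add(1)[of p x "- y"] assms by (simp add: lp_minus)

lemma nrm_lp_nonneg:
  fixes x :: "nat \<Rightarrow> 'k::real_normed_field"
  assumes "x \<in> pts (lp p :: ('k, _) nspace)"
  shows "0 \<le> nrm (lp p :: ('k, _) nspace) x"
proof (cases "p = \<infinity>")
  case True
  then have "bdd_above (range (\<lambda>n. norm (x n)))"
    using assms by (intro bdd_above_norm_lp_infinity) simp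
  then have "norm (x 0) \<le> (SUP n. norm (x n))" by (intro cSUP_upper) auto
  then have "0 \<le> (SUP n. norm (x n))" by (rule order_trans[OF norm_ge_zero])
  then show ?thesis using True by (simp add: lp_def)
qed (simp add: lp_def)

lemma nrm_lp_eq_0_iff:
  fixes x :: "nat \<Rightarrow> 'k::real_normed_field"
  assumes "x \<in> pts (lp p :: ('k, _) nspace)"
  shows "nrm (lp p :: ('k, _) nspace) x = 0 \<longleftrightarrow> x = 0"
proof (cases "p = \<infinity>")
  case True
  then have "bdd_above (range (\<lambda>n. norm (x n)))"
    using assms by (intro bdd_above_norm_lp_infinity) simp
  then have "norm (x n) \<le> (SUP n. norm (x n))" for n by (rule cSUP_upper[OF UNIV_I])
  then show ?thesis using True by (auto simp: lp_def fun_eq_iff)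
next
  case False
  then show ?thesis
    using assms suminf_eq_zero_iff[of "\<lambda>n. norm (x n) powr enn2real p"]
    by (auto simp: lp_def fun_eq_iff)
qed

lemma Metric_space_lp:
  fixes E :: "('k::real_normed_field, _) nspace"
  assumes "1 \<le> p"
  defines "E \<equiv> lp p"
  shows "Metric_space (pts E) (\<lambda>x y. if x \<in> pts E \<and> y \<in> pts E then nrm E (x - y) else 0)"
proof
  fix x y z
  show "0 \<le> (if x \<in> pts E \<and> y \<in> pts E then nrm E (x - y) else 0)"
    using assms by (simp add: lp_diff nrm_lp_nonneg)
  show "(if x \<in> pts E \<and> y \<in> pts E then nrm E (x - y) else 0) =
      (if y \<in> pts E \<and> x \<in> pts E then nrm E (y - x) else 0)"
    using lp_minus(2)[of p "x - y"] assms by auto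
  show "(if x \<in> pts E \<and> y \<in> pts E then nrm E (x - y) else 0) = 0 \<longleftrightarrow> x = y"
    if "x \<in> pts E" "y \<in> pts E"
    using that assms by (simp add: lp_diff nrm_lp_eq_0_iff)
  show "(if x \<in> pts E \<and> z \<in> pts E then nrm E (x - z) else 0)
      \<le> (if x \<in> pts E \<and> y \<in> pts E then nrm E (x - y) else 0)
        + (if y \<in> pts E \<and> z \<in> pts E then nrm E (y - z) else 0)"
    if "x \<in> pts E" "y \<in> pts E" "z \<in> pts E"
    using lp_add(2)[of p "x - y" "y - z"] that assms by (simp add: lp_diff)
qed

section \<open>Finitely supported sequences\<close>

lemma nrm_lp_finite_support:
  fixes x :: "nat \<Rightarrow> 'k::real_normed_field"
  assumes "p \<noteq> \<infinity>" "\<And>k. n \<le> k \<Longrightarrow> x k = 0"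
  shows "nrm (lp p :: ('k, _) nspace) x = (\<Sum>k<n. norm (x k) powr enn2real p) powr (1 / enn2real p)"
proof -
  have "(\<Sum>k. norm (x k) powr enn2real p) = (\<Sum>k<n. norm (x k) powr enn2real p)"
    using assms(2) by (intro suminf_finite) (auto simp: not_less)
  then show ?thesis using assms(1) by (simp add: lp_def)
qed

lemma lp_finite_support:
  fixes x :: "nat \<Rightarrow> 'k::real_normed_field"
  assumes "\<And>k. n \<le> k \<Longrightarrow> x k = 0"
  shows "x \<in> pts (lp p :: ('k, _) nspace)"
proof (cases "p = \<infinity>")
  case True
  have "x k \<in> insert 0 (x ` {..<n})" for k
    using assms[of k] by (cases "k < n") auto
  then have "range x \<subseteq> insert 0 (x ` {..<n})"
    by (rule image_subsetI)
  then have "finite (range x)"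
    by (rule finite_subset) simp
  then show ?thesis using True by (simp add: lp_def finite_imp_bounded)
next
  case False
  have "summable (\<lambda>k. norm (x k) powr enn2real p)"
    using assms by (intro summable_finite[of "{..<n}"]) (auto simp: not_less)
  then show ?thesis using False by (simp add: lp_def)
qed

lemma nrm_lp_infinity_le:
  fixes x :: "nat \<Rightarrow> 'k::real_normed_field"
  assumes "\<And>k. norm (x k) \<le> a"
  shows "nrm (lp \<infinity> :: ('k, _) nspace) x \<le> a"
  using assms by (auto simp: lp_def intro!: cSUP_least)

text \<open>With \<open>?S\<close> the l_1 norm, each term \<open>norm (x k) powr s\<close> is at
  most \<open>norm (x k) * ?S powr (s - 1)\<close>, and these bounds sum to
  \<open>?S powr s\<close>.\<close>

lemma nrm_lp_le_sum:
  fixes x :: "nat \<Rightarrow> 'k::real_normed_field"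
  assumes "1 \<le> p" "\<And>k. n \<le> k \<Longrightarrow> x k = 0"
  shows "nrm (lp p :: ('k, _) nspace) x \<le> (\<Sum>k<n. norm (x k))" (is "_ \<le> ?S")
proof -
  have le: "norm (x k) \<le> ?S" if "k < n" for k
    using that by (intro member_le_sum) auto
  show ?thesis
  proof (cases "p = \<infinity>")
    case True
    have "norm (x k) \<le> ?S" for k
      using le[of k] assms(2)[of k] by (cases "k < n") (auto simp: sum_nonneg)
    then show ?thesis using True nrm_lp_infinity_le by metis
  next
    case False
    define s where "s = enn2real p"
    have s: "1 \<le> s" unfolding s_def by (rule enn2real_ge_1[OF assms(1) False])
    have split: "t powr s = t * t powr (s - 1)" if "0 \<le> t" for t :: real
      using that by (cases "t = 0") (simp_all add: powr_mult_base)
    have "(\<Sum>k<n. norm (x k) powr s) \<le> (\<Sum>k<n. norm (x k) * ?S powr (s - 1))"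
      unfolding split[OF norm_ge_zero]
      using s le by (intro sum_mono mult_left_mono powr_mono2) auto
    also have "\<dots> = ?S powr s"
      by (simp add: split[of ?S] sum_nonneg sum_distrib_right)
    finally have "(\<Sum>k<n. norm (x k) powr s) powr (1 / s) \<le> (?S powr s) powr (1 / s)"
      using s by (intro powr_mono2 sum_nonneg) auto
    also have "\<dots> = ?S" using s by (simp add: powr_powr sum_nonneg)
    finally show ?thesis
      using nrm_lp_finite_support[OF False assms(2)] by (simp add: s_def)
  qed
qed

text \<open>The values are supported in the first \<open>n\<close> coordinates, where the norm is
  dominated by the l_1 norm, so continuity of the coordinates suffices.\<close>

lemma continuous_map_into_lp:
  fixes T :: "'a \<Rightarrow> nat \<Rightarrow> 'k::real_normed_field"
  assumes "1 \<le> p" "\<And>x k. n \<le> k \<Longrightarrow> T x k = 0"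
    and cont: "\<And>k. k < n \<Longrightarrow> continuous_map X euclidean (\<lambda>x. T x k)"
  shows "continuous_map X (norm_topology (lp p :: ('k, _) nspace)) T"
  unfolding norm_topology_def Metric_space.continuous_map_to_metric[OF Metric_space_lp[OF assms(1)]]
proof (intro ballI allI impI)
  fix x and \<epsilon> :: real
  assume x: "x \<in> topspace X" and "0 < \<epsilon>"
  define g where "g = (\<lambda>y. \<Sum>k<n. norm (T x k - T y k))"
  have "continuous_map X euclideanreal g"
    unfolding g_def by (intro continuous_map_sum continuous_map_norm continuous_map_diff cont) auto
  then have "openin X {y \<in> topspace X. g y \<in> {..<\<epsilon>}}"
    by (rule openin_continuous_map_preimage) (simp flip: open_openin)
  moreover have "nrm (lp p :: ('k, _) nspace) (T x - T y) \<le> g y" for y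
    using nrm_lp_le_sum[of p n "T x - T y"] assms by (simp add: g_def)
  moreover have "T y \<in> pts (lp p :: ('k, _) nspace)" for y
    by (rule lp_finite_support) (rule assms(2))
  ultimately show "\<exists>U. openin X U \<and> x \<in> U \<and> (\<forall>y\<in>U. T y \<in> Metric_space.mball (pts (lp p :: ('k, _) nspace))
      (\<lambda>x y. if x \<in> pts (lp p) \<and> y \<in> pts (lp p) then nrm (lp p) (x - y) else 0) (T x) \<epsilon>)"
    using x \<open>0 < \<epsilon>\<close>
    by (intro exI[of _ "{y \<in> topspace X. g y \<in> {..<\<epsilon>}}"])
      (auto simp: Metric_space.in_mball[OF Metric_space_lp[OF assms(1)]] g_def intro: le_less_trans)
qed

section \<open>The space l_1 and its dual\<close>

lemma pts_lp_1: "pts (lp 1 :: ('k::real_normed_field, _) nspace) = {x. summable (\<lambda>n. norm (x n))}"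
  by (simp add: lp_def)

lemma nrm_lp_1:
  fixes x :: "nat \<Rightarrow> 'k::real_normed_field"
  assumes "x \<in> pts (lp 1 :: ('k, _) nspace)"
  shows "nrm (lp 1 :: ('k, _) nspace) x = (\<Sum>n. norm (x n))"
  using assms by (simp add: lp_def suminf_nonneg)

lemma sum_norm_le_nrm_lp_1:
  fixes x :: "nat \<Rightarrow> 'k::real_normed_field"
  assumes "x \<in> pts (lp 1 :: ('k, _) nspace)" "finite A"
  shows "(\<Sum>k\<in>A. norm (x k)) \<le> nrm (lp 1 :: ('k, _) nspace) x"
  using assms unfolding nrm_lp_1[OF assms(1)] by (intro sum_le_suminf) (auto simp: pts_lp_1)

lemma continuous_map_lp_coordinate:
  "continuous_map (norm_topology (lp 1 :: ('k::real_normed_field, _) nspace)) euclidean (\<lambda>x. x k)"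
proof -
  let ?E = "lp 1 :: ('k, _) nspace"
  have "norm (x k - y k) \<le> nrm ?E (x - y)" if "x \<in> pts ?E" "y \<in> pts ?E" for x y
    using sum_norm_le_nrm_lp_1[of "x - y" "{k}"] lp_diff[of 1 x y] that by simp
  then show ?thesis
    unfolding norm_topology_def mtopology_is_euclidean[symmetric]
    by (subst Metric_space.metric_continuous_map[OF Metric_space_lp Met_TC.Metric_space_axioms])
      (auto simp: dist_norm intro: le_less_trans)
qed

definition basis :: "nat \<Rightarrow> nat \<Rightarrow> 'k::real_normed_field" where
  "basis k i = (if i = k then 1 else 0)"

lemma basis_in_pts: "basis k \<in> pts (lp p :: ('k::real_normed_field, _) nspace)"
  by (rule lp_finite_support[of "Suc k"]) (simp add: basis_def)

lemma scale_lp_1: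
  fixes x :: "nat \<Rightarrow> 'k::real_normed_field"
  assumes "x \<in> pts (lp 1 :: ('k, _) nspace)"
  shows "scale (lp 1 :: ('k, _) nspace) a x \<in> pts (lp 1 :: ('k, _) nspace)"
    and "nrm (lp 1 :: ('k, _) nspace) (scale (lp 1 :: ('k, _) nspace) a x)
      = norm a * nrm (lp 1 :: ('k, _) nspace) x"
proof -
  have s: "scale (lp 1 :: ('k, _) nspace) a x = (\<lambda>n. a * x n)"
    by (simp add: lp_def)
  show in_pts: "scale (lp 1 :: ('k, _) nspace) a x \<in> pts (lp 1 :: ('k, _) nspace)"
    using assms by (simp add: s pts_lp_1 norm_mult summable_mult)
  show "nrm (lp 1 :: ('k, _) nspace) (scale (lp 1 :: ('k, _) nspace) a x)
      = norm a * nrm (lp 1 :: ('k, _) nspace) x"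
    using assms unfolding nrm_lp_1[OF in_pts] nrm_lp_1[OF assms]
    by (simp add: s norm_mult suminf_mult pts_lp_1)
qed

text \<open>\<open>dual_norm\<close> is a supremum of reals, so it bounds the values of
  \<open>f\<close> on the unit ball only once these are known to be bounded. This follows from
  continuity at 0 by scaling.\<close>

lemma dual_space_bounded:
  fixes f :: "(nat \<Rightarrow> 'k::real_normed_field) \<Rightarrow> 'k"
  assumes f: "f \<in> dual_space (lp 1)"
  shows "bdd_above ((\<lambda>x. norm (f x)) ` unit_ball (lp 1))"
proof -
  let ?E = "lp 1 :: ('k, _) nspace"
  have scale: "f (scale ?E a x) = a * f x" if "x \<in> pts ?E" for a x
    using f that by (simp add: dual_space_def)
  have 0: "0 \<in> pts ?E" by (simp add: pts_lp_1)
  have "f 0 = 0"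
    using scale[OF 0, of 0] by (simp add: lp_def zero_fun_def)
  moreover have "\<exists>\<delta>>0. \<forall>x. x \<in> pts ?E \<and> (if 0 \<in> pts ?E \<and> x \<in> pts ?E then nrm ?E (0 - x) else 0) < \<delta>
      \<longrightarrow> dist (f 0) (f x) < 1"
  proof -
    have "continuous_map (norm_topology ?E) euclidean f"
      using f by (simp add: dual_space_def)
    then show ?thesis
      unfolding norm_topology_def mtopology_is_euclidean[symmetric]
        Metric_space.metric_continuous_map[OF Metric_space_lp[OF order_refl] Met_TC.Metric_space_axioms]
      using 0 zero_less_one by blast
  qed
  ultimately obtain \<delta> where \<delta>: "0 < \<delta>" "\<And>x. x \<in> pts ?E \<Longrightarrow> nrm ?E x < \<delta> \<Longrightarrow> norm (f x) < 1"
    using 0 by (auto simp: lp_minus(2))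
  have "norm (f x) \<le> 2 / \<delta>" if "x \<in> unit_ball ?E" for x
  proof -
    \<comment> \<open>Half of \<open>\<delta>\<close> keeps the norm strictly below
      \<open>\<delta>\<close> even for \<open>x\<close> on the unit sphere.\<close>
    let ?a = "of_real (\<delta> / 2) :: 'k"
    have x: "x \<in> pts ?E" "nrm ?E x \<le> 1" using that by (auto simp: unit_ball_def)
    have "nrm ?E (scale ?E ?a x) \<le> \<delta> / 2"
      using x(2) \<delta>(1) by (simp add: scale_lp_1[OF x(1)] mult_left_le)
    then have "norm (f (scale ?E ?a x)) < 1"
      using \<delta> x(1) by (intro \<delta>(2) scale_lp_1) auto
    then show ?thesis
      using \<delta>(1) by (simp add: scale[OF x(1)] norm_mult field_simps)
  qed
  then show ?thesis by (auto intro!: bdd_aboveI)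
qed

lemma dual_ball_basis_le_1:
  fixes f :: "(nat \<Rightarrow> 'k::real_normed_field) \<Rightarrow> 'k"
  assumes f: "f \<in> dual_ball (lp 1)"
  shows "norm (f (basis k)) \<le> 1"
proof -
  have "nrm (lp 1 :: ('k, _) nspace) (basis k) \<le> 1"
    using nrm_lp_le_sum[of 1 "Suc k" "basis k :: nat \<Rightarrow> 'k"] by (simp add: basis_def)
  then have "basis k \<in> unit_ball (lp 1 :: ('k, _) nspace)"
    by (simp add: unit_ball_def basis_in_pts)
  then have "norm (f (basis k)) \<le> dual_norm (lp 1) f"
    unfolding dual_norm_def using f
    by (intro cSUP_upper dual_space_bounded) (auto simp: dual_ball_def)
  then show ?thesis using f by (simp add: dual_ball_def)
qed

lemma dual_space_finite_support:
  fixes f :: "(nat \<Rightarrow> 'k::real_normed_field) \<Rightarrow> 'k"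
  assumes f: "f \<in> dual_space (lp 1)"
  shows "f (\<lambda>k. if k < n then a k else 0) = (\<Sum>k<n. a k * f (basis k))"
proof (induction n)
  let ?E = "lp 1 :: ('k, _) nspace"
  have scale: "f (scale ?E b x) = b * f x" if "x \<in> pts ?E" for b x
    using f that by (simp add: dual_space_def)
  case 0
  show ?case using scale[of 0 0] by (simp add: lp_def zero_fun_def)
next
  let ?E = "lp 1 :: ('k, _) nspace"
  case (Suc n)
  have eq: "(\<lambda>k. if k < Suc n then a k else 0)
      = (\<lambda>k. if k < n then a k else 0) + scale ?E (a n) (basis n)"
    by (auto simp: fun_eq_iff lp_def basis_def less_Suc_eq)
  have "(\<lambda>k. if k < n then a k else 0) \<in> pts ?E"
    by (rule lp_finite_support[of n]) simp
  moreover have "scale ?E (a n) (basis n) \<in> pts ?E"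
    by (intro scale_lp_1 basis_in_pts)
  ultimately show ?case
    unfolding eq using f basis_in_pts[of n 1, where 'k = 'k] Suc by (simp add: dual_space_def)
qed

text \<open>The supremum in \<open>weak1_norm\<close> is thus over a nonempty set, and the zero
  functional shows that it is nonnegative.\<close>

lemma zero_in_dual_ball: "(\<lambda>_. 0) \<in> dual_ball (lp 1 :: ('k::real_normed_field, _) nspace)"
proof -
  have "0 \<in> unit_ball (lp 1 :: ('k, _) nspace)"
    by (simp add: unit_ball_def lp_def)
  then have "dual_norm (lp 1 :: ('k, _) nspace) (\<lambda>_. 0) = 0"
    unfolding dual_norm_def by (subst cSUP_const) auto
  then show ?thesis by (simp add: dual_ball_def dual_space_def)
qed

section \<open>Lower bounds for the summing constants\<close>

lemma norm_le_nrm_lp: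
  fixes x :: "nat \<Rightarrow> 'k::real_normed_field"
  assumes "1 \<le> p" "\<And>k. n \<le> k \<Longrightarrow> x k = 0"
  shows "norm (x k) \<le> nrm (lp p :: ('k, _) nspace) x"
proof (cases "p = \<infinity>")
  case True
  have "bdd_above (range (\<lambda>n. norm (x n)))"
    by (intro bdd_above_norm_lp_infinity lp_finite_support assms(2))
  then show ?thesis using True by (auto simp: lp_def intro: cSUP_upper)
next
  case False
  define s where "s = enn2real p"
  have s: "1 \<le> s" unfolding s_def by (rule enn2real_ge_1[OF assms(1) False])
  have "norm (x k) powr s \<le> (\<Sum>k<n. norm (x k) powr s)"
    using assms(2)[of k] by (cases "k < n") (auto intro: member_le_sum sum_nonneg)
  then have "(norm (x k) powr s) powr (1 / s) \<le> (\<Sum>k<n. norm (x k) powr s) powr (1 / s)"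
    using s by (intro powr_mono2) auto
  then show ?thesis
    using s nrm_lp_finite_support[OF False assms(2)] by (simp add: s_def powr_powr)
qed

lemma character_in_pts: "character d j \<in> pts (lp p :: ('k::real_normed_field, _) nspace)"
  by (rule lp_finite_support[of "2 ^ d"]) (simp add: character_def)

text \<open>The values of \<open>f\<close> at the characters form the Walsh transform of the
  coefficients \<open>f (basis k)\<close>, which are bounded by 1.\<close>

lemma dual_ball_character_sum_le:
  fixes f :: "(nat \<Rightarrow> 'k::{real_normed_field,real_inner}) \<Rightarrow> 'k"
  assumes f: "f \<in> dual_ball (lp 1)"
  shows "(\<Sum>j<2 ^ d. norm (f (character d j))) \<le> (2 ^ d) powr (3/2)"
proof -
  have "f (character d j) = walsh_transform d (\<lambda>k. f (basis k)) j" for j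
    using f dual_space_finite_support[of f "2 ^ d" "\<lambda>k. of_real (walsh d j k)"]
    by (simp add: dual_ball_def character_def[abs_def] walsh_transform_def scaleR_conv_of_real)
  then show ?thesis
    using sum_norm_walsh_transform_le[of d "\<lambda>k. f (basis k)"] dual_ball_basis_le_1[OF f] by simp
qed

lemma weak1_norm_character:
  shows "weak1_norm (lp 1 :: ('k::{real_normed_field,real_inner}, _) nspace) (2 ^ d) (character d) \<le> (2 ^ d) powr (3/2)"
    and "0 \<le> weak1_norm (lp 1 :: ('k, _) nspace) (2 ^ d) (character d)"
proof -
  let ?g = "\<lambda>f :: (nat \<Rightarrow> 'k) \<Rightarrow> 'k. \<Sum>j<2 ^ d. norm (f (character d j))"
  show "weak1_norm (lp 1 :: ('k, _) nspace) (2 ^ d) (character d) \<le> (2 ^ d) powr (3/2)"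
    unfolding weak1_norm_def
    using zero_in_dual_ball by (intro cSUP_least dual_ball_character_sum_le) auto
  have "bdd_above (?g ` dual_ball (lp 1))"
    using dual_ball_character_sum_le by (intro bdd_aboveI2)
  then have "?g (\<lambda>_. 0) \<le> weak1_norm (lp 1 :: ('k, _) nspace) (2 ^ d) (character d)"
    unfolding weak1_norm_def by (intro cSUP_upper zero_in_dual_ball)
  then show "0 \<le> weak1_norm (lp 1 :: ('k, _) nspace) (2 ^ d) (character d)" by simp
qed

section \<open>Multilinearity and continuity of the test operators\<close>

lemma walsh_transform_add: "walsh_transform d (u + v) j = walsh_transform d u j + walsh_transform d v j"
  by (simp add: walsh_transform_def scaleR_add_right sum.distrib)

lemma walsh_transform_scale:
  fixes u :: "nat \<Rightarrow> 'k::real_normed_field"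
  shows "walsh_transform d (scale (lp p) a u) j = a * walsh_transform d u j"
  by (simp add: walsh_transform_def lp_def sum_distrib_left)

text \<open>Isolates the only factor that depends on the argument \<open>i\<close>, so that
  linearity in this argument can be read off.\<close>

lemma fourier_op_update:
  assumes "i < m"
  shows "fourier_op d m c (x(i := w)) s = (if s < 2 ^ d then \<Sum>j<2 ^ d.
    c j s *\<^sub>R (walsh_transform d w j * (\<Prod>q\<in>{..<m} - {i}. walsh_transform d (x q) j)) else 0)"
proof -
  have "(\<Prod>q<m. walsh_transform d ((x(i := w)) q) j)
      = walsh_transform d w j * (\<Prod>q\<in>{..<m} - {i}. walsh_transform d (x q) j)" for j
    using assms by (subst prod.remove[of _ i]) (auto intro: prod.cong)
  then show ?thesis by (simp add: fourier_op_def)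
qed

text \<open>Continuity holds because only the first \<open>2 ^ d\<close> coordinates of the value
  can be nonzero, and each is a polynomial in finitely many coordinates of the arguments.\<close>

lemma fourier_op_in_multilinear_operators:
  assumes "1 \<le> p"
  shows "fourier_op d m c \<in> multilinear_operators m (lp 1 :: ('k::real_normed_field, _) nspace) (lp p)"
proof -
  let ?E = "lp 1 :: ('k, _) nspace"
  let ?X = "product_topology (\<lambda>_. norm_topology ?E) {..<m}"
  have "multilinear_on m ?E (lp p) (fourier_op d m c)"
    unfolding multilinear_on_def
    by (simp add: fun_eq_iff fourier_op_update walsh_transform_add walsh_transform_scale
        distrib_right scaleR_add_right sum.distrib)
      (simp add: lp_def fourier_op_update sum_distrib_left mult.assoc)
  moreover have "continuous_map ?X (norm_topology (lp p :: ('k, _) nspace)) (fourier_op d m c)"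
  proof (rule continuous_map_into_lp[OF assms, of "2 ^ d"])
    have coord: "continuous_map ?X euclidean (\<lambda>x. x q k)" if "q < m" for q k
      using continuous_map_compose[OF continuous_map_product_projection[of q "{..<m}"]
          continuous_map_lp_coordinate[of k]] that by (simp add: o_def)
    have "continuous_map ?X euclidean (\<lambda>x. walsh_transform d (x q) j)" if "q < m" for q j
      using coord[OF that] unfolding walsh_transform_def continuous_map_atin
      by (simp add: tendsto_sum tendsto_scaleR)
    then show "continuous_map ?X euclidean (\<lambda>x. fourier_op d m c x s)" if "s < 2 ^ d" for s
      using that unfolding fourier_op_def continuous_map_atin
      by (auto intro!: tendsto_sum tendsto_scaleR tendsto_prod)
  qed (simp add: fourier_op_def)
  ultimately show ?thesis by (simp add: multilinear_operators_def)
qed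

section \<open>Testing on characters and comparing growth in the group order\<close>

text \<open>The summing inequality is tested with \<open>N = 2 ^ d\<close> and the family of all
  characters in each of the \<open>m\<close> slots. \<open>B\<close> bounds the operator norm,
  \<open>A\<close> bounds the norms of the images from below, and each slot contributes a weak norm
  of at most \<open>(2 ^ d) powr (3/2)\<close>.\<close>

lemma summing_constant_lower_bound:
  fixes c :: "nat \<Rightarrow> nat \<Rightarrow> real"
  assumes "1 \<le> m" "1 \<le> p" "0 < r" "0 < C"
    and summing: "\<And>T. T \<in> multilinear_operators m (lp 1 :: ('k::{real_normed_field,real_inner}, _) nspace) (lp p)
      \<Longrightarrow> pi_as m r (lp 1) (lp p) T \<le> ennreal (C * op_norm m (lp 1) (lp p) T)"
    and "1 \<le> B" "0 \<le> A"
    and upper: "\<And>x :: nat \<Rightarrow> nat \<Rightarrow> 'k.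
      nrm (lp p :: ('k, _) nspace) (fourier_op d m c x) \<le> B * (\<Prod>q<m. \<Sum>k<2 ^ d. norm (x q k))"
    and lower: "\<And>x j. j < 2 ^ d \<Longrightarrow> (\<And>q. q < m \<Longrightarrow> x q = character d j)
      \<Longrightarrow> A \<le> nrm (lp p :: ('k, _) nspace) (fourier_op d m c x)"
  shows "A * (2 ^ d) powr (1 / r) \<le> (C + 1) * B * (2 ^ d) powr (3 * m / 2)"
proof -
  let ?E = "lp 1 :: ('k, _) nspace" and ?F = "lp p :: ('k, _) nspace"
  let ?T = "fourier_op d m c :: (nat \<Rightarrow> nat \<Rightarrow> 'k) \<Rightarrow> nat \<Rightarrow> 'k"
  let ?w = "weak1_norm ?E (2 ^ d) (character d)"
  have "op_norm m ?E ?F ?T \<le> B"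
    unfolding op_norm_def
  proof (rule cSUP_least)
    have "0 \<in> unit_ball ?E" by (simp add: unit_ball_def lp_def)
    then show "({..<m} \<rightarrow>\<^sub>E unit_ball ?E) \<noteq> {}" by (auto simp: PiE_eq_empty_iff)
    fix x assume x: "x \<in> {..<m} \<rightarrow>\<^sub>E unit_ball ?E"
    have "(\<Prod>q<m. \<Sum>k<2 ^ d. norm (x q k)) \<le> (\<Prod>q<m. 1)"
    proof (intro prod_mono conjI sum_nonneg norm_ge_zero)
      fix q assume "q \<in> {..<m}"
      then have "x q \<in> pts ?E" "nrm ?E (x q) \<le> 1"
        using x by (auto simp: unit_ball_def PiE_iff)
      then show "(\<Sum>k<2 ^ d. norm (x q k)) \<le> 1"
        using sum_norm_le_nrm_lp_1[of "x q" "{..<2 ^ d}"] by simp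
    qed
    then have "B * (\<Prod>q<m. \<Sum>k<2 ^ d. norm (x q k)) \<le> B * 1"
      using \<open>1 \<le> B\<close> by (intro mult_left_mono) auto
    then show "nrm ?F (?T x) \<le> B" using upper[of x] by simp
  qed
  then have "C * op_norm m ?E ?F ?T \<le> C * B" using \<open>0 < C\<close> by simp
  \<comment> \<open>Passing from \<open>C\<close> to \<open>C + 1\<close> makes the inequality
    strict, so the infimum in \<open>pi_as\<close> yields an actual summing constant
    \<open>K\<close> below \<open>(C + 1) * B\<close>.\<close>
  also have "\<dots> < (C + 1) * B" using \<open>1 \<le> B\<close> by (simp add: algebra_simps)
  finally have "ennreal (C * op_norm m ?E ?F ?T) < ennreal ((C + 1) * B)"
    using \<open>0 < C\<close> \<open>1 \<le> B\<close> by (intro ennreal_lessI) auto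
  then have "pi_as m r ?E ?F ?T < ennreal ((C + 1) * B)"
    using summing[OF fourier_op_in_multilinear_operators[OF assms(2)]] by (rule le_less_trans[rotated])
  then obtain K where K: "0 \<le> K" "summing_bound m r ?E ?F ?T K" "ennreal K < ennreal ((C + 1) * B)"
    unfolding pi_as_def Inf_less_iff by blast
  then have "K \<le> (C + 1) * B" by (simp add: ennreal_less_iff less_imp_le)
  define S where "S = (\<Sum>j<2 ^ d. nrm ?F (?T (\<lambda>q\<in>{..<m}. character d j)) powr r)"
  have "A powr r \<le> nrm ?F (?T (\<lambda>q\<in>{..<m}. character d j)) powr r" if "j < 2 ^ d" for j
    using \<open>0 \<le> A\<close> \<open>0 < r\<close> that by (intro powr_mono2 lower) auto
  then have "(\<Sum>j<(2::nat) ^ d. A powr r) \<le> S"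
    unfolding S_def by (intro sum_mono) auto
  then have "2 ^ d * A powr r \<le> S" by simp
  then have "(2 ^ d * A powr r) powr (1 / r) \<le> S powr (1 / r)"
    using \<open>0 < r\<close> by (intro powr_mono2) auto
  moreover have "(2 ^ d * A powr r) powr (1 / r) = A * (2 ^ d) powr (1 / r)"
    using \<open>0 < r\<close> \<open>0 \<le> A\<close> by (simp add: powr_mult powr_powr)
  moreover have "S powr (1 / r) \<le> K * (\<Prod>q<m. ?w)"
    using K(2)[unfolded summing_bound_def, rule_format, of "2 ^ d" "\<lambda>_. character d"]
    by (simp add: S_def character_in_pts)
  moreover have "K * (\<Prod>q<m. ?w) \<le> (C + 1) * B * (\<Prod>q<m. (2 ^ d) powr (3/2))"
    using weak1_norm_character \<open>0 \<le> K\<close> \<open>K \<le> (C + 1) * B\<close>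
    by (intro mult_mono prod_mono prod_nonneg) auto
  moreover have "(\<Prod>q<m. ((2::real) ^ d) powr (3/2)) = (2 ^ d) powr (3 * m / 2)"
    by (simp add: powr_power mult.commute)
  ultimately show ?thesis by simp
qed

text \<open>If \<open>a\<close> exceeded \<open>b\<close>, the quotient of the two powers would be a
  geometric sequence in \<open>d\<close> with ratio above 1, hence not bounded by
  \<open>K\<close>.\<close>

lemma exponent_le_of_power2_le:
  fixes a b K :: real
  assumes "\<And>d :: nat. (2 ^ d) powr a \<le> K * (2 ^ d) powr b"
  shows "a \<le> b"
proof (rule ccontr)
  assume "\<not> a \<le> b"
  then have "1 < (2::real) powr (a - b)" by simp
  then obtain d where "K < (2 powr (a - b)) ^ d"
    using real_arch_pow by blast
  also have "(2 powr (a - b)) ^ d = ((2::real) ^ d) powr a / (2 ^ d) powr b"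
    by (simp add: powr_diff[symmetric] powr_power mult.commute flip: powr_realpow) (simp add: powr_powr mult.commute)
  finally show False using assms[of d] by (simp add: field_simps)
qed

text \<open>Convolution settles \<open>p \<le> 2\<close> and the product of the transforms settles
  \<open>p > 2\<close>, including infinity. Each case bounds \<open>1 / r\<close> by the reciprocal
  of the critical exponent.\<close>

lemma critical_exponent_le:
  assumes "1 \<le> m" "1 \<le> p" "0 < r" "0 < C"
    and summing: "\<And>T. T \<in> multilinear_operators m (lp 1 :: ('k::{real_normed_field,real_inner}, _) nspace) (lp p)
      \<Longrightarrow> pi_as m r (lp 1) (lp p) T \<le> ennreal (C * op_norm m (lp 1) (lp p) T)"
  shows "critical_exponent m p \<le> r"
proof -
  let ?F = "lp p :: ('k, _) nspace"
  let ?P = "\<lambda>d. fourier_op d m (\<lambda>j s. of_bool (j = s)) :: (nat \<Rightarrow> nat \<Rightarrow> 'k) \<Rightarrow> nat \<Rightarrow> 'k"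
  let ?Q = "\<lambda>d. fourier_op d m (\<lambda>j s. walsh d j s / 2 ^ d) :: (nat \<Rightarrow> nat \<Rightarrow> 'k) \<Rightarrow> nat \<Rightarrow> 'k"
  have product_lower: "(2 ^ d) ^ m \<le> nrm ?F (?P d x)"
    if "j < 2 ^ d" "\<And>q. q < m \<Longrightarrow> x q = character d j" for d j x
  proof -
    have "norm (?P d x j) = (2 ^ d) ^ m"
      using that assms(1) by (subst fourier_op_character[of j]) (auto simp: norm_power)
    moreover have "norm (?P d x j) \<le> nrm ?F (?P d x)"
      by (rule norm_le_nrm_lp[OF assms(2), of "2 ^ d"]) (simp add: fourier_op_def)
    ultimately show ?thesis by simp
  qed
  \<comment> \<open>Here \<open>A = (2 ^ d) ^ m\<close> and \<open>B = (2 ^ d) powr t\<close>. The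
    value of \<open>t\<close> will be 0 for \<open>p = \<infinity>\<close> and \<open>1 / s\<close>
    for finite \<open>p\<close>.\<close>
  have product_bound: "1 / r \<le> m / 2 + t"
    if "0 \<le> t" and upper: "\<And>d x. nrm ?F (?P d x) \<le> (2 ^ d) powr t * (\<Prod>q<m. \<Sum>k<2 ^ d. norm (x q k))" for t
  proof -
    have "((2::real) ^ d) powr (m + 1 / r) \<le> (C + 1) * (2 ^ d) powr (3 * m / 2 + t)" for d
    proof -
      have "((2::real) ^ d) powr (m + 1 / r) = (2 ^ d) ^ m * (2 ^ d) powr (1 / r)"
        by (simp add: powr_add powr_realpow)
      also have "\<dots> \<le> (C + 1) * (2 ^ d) powr t * (2 ^ d) powr (3 * m / 2)"
        using \<open>0 \<le> t\<close>
        by (intro summing_constant_lower_bound[OF assms _ _ upper product_lower] ge_one_powr_ge_zero) auto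
      also have "\<dots> = (C + 1) * (2 ^ d) powr (3 * m / 2 + t)"
        by (simp only: powr_add mult.assoc mult.commute[of "(2 ^ d) powr t"])
      finally show ?thesis .
    qed
    then have "m + 1 / r \<le> 3 * m / 2 + t" by (rule exponent_le_of_power2_le)
    then show ?thesis by simp
  qed
  have invert: "1 / e \<le> r" if "1 / r \<le> e" for e
  proof -
    have "0 < e" using that \<open>0 < r\<close> by (meson divide_pos_pos less_le_trans zero_less_one)
    then show ?thesis using that \<open>0 < r\<close> by (simp add: field_simps)
  qed
  show ?thesis
  proof (cases "p = \<infinity>")
    case True
    have "nrm ?F (?P d x) \<le> (2 ^ d) powr 0 * (\<Prod>q<m. \<Sum>k<2 ^ d. norm (x q k))" for d x
      unfolding True by (intro nrm_lp_infinity_le) (simp add: norm_transform_product_le)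
    then have "1 / r \<le> m / 2 + 0" by (intro product_bound) auto
    then show ?thesis using invert[of "m / 2"] True by (simp add: critical_exponent_def)
  next
    case False
    define s where "s = enn2real p"
    have s: "1 \<le> s" unfolding s_def by (rule enn2real_ge_1[OF assms(2) False])
    have nrm_F: "nrm ?F (fourier_op d m c x) = (\<Sum>k<2 ^ d. norm (fourier_op d m c x k) powr s) powr (1 / s)" for d c x
      unfolding s_def by (rule nrm_lp_finite_support[OF False]) (simp add: fourier_op_def)
    show ?thesis
    proof (cases "s \<le> 2")
      case True
      have upper: "nrm ?F (?Q d x) \<le> 1 * (\<Prod>q<m. \<Sum>k<2 ^ d. norm (x q k))" for d x
        using nrm_lp_le_sum[OF assms(2), of "2 ^ d" "?Q d x"] sum_norm_convolution_le[of d m x]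
        by (simp add: fourier_op_def)
      \<comment> \<open>The image of a character has constant modulus
        \<open>(2 ^ d) powr (real m - 1)\<close> on the whole group; its \<open>2 ^ d\<close>
        coordinates account for the extra \<open>1 / s\<close>.\<close>
      have lower: "(2 ^ d) powr (real m - 1 + 1 / s) \<le> nrm ?F (?Q d x)"
        if "j < 2 ^ d" "\<And>q. q < m \<Longrightarrow> x q = character d j" for d j x
      proof -
        have "norm (?Q d x k) = (2 ^ d) powr (real m - 1)" if "k < 2 ^ d" for k
        proof -
          have "?Q d x k = of_real (walsh d j k / 2 ^ d * (2 ^ d) ^ m)"
            using \<open>j < 2 ^ d\<close> that assms(1) \<open>\<And>q. q < m \<Longrightarrow> x q = character d j\<close>
            by (intro fourier_op_character) auto
          then have "norm (?Q d x k) = (2 ^ d) ^ m / 2 ^ d"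
            by (simp only: norm_of_real abs_mult abs_divide abs_walsh) simp
          also have "\<dots> = (2 ^ d) powr (real m - 1)"
            using assms(1) by (cases m) (simp_all add: powr_realpow)
          finally show ?thesis .
        qed
        then have "nrm ?F (?Q d x) = (2 ^ d * ((2 ^ d) powr (real m - 1)) powr s) powr (1 / s)"
          unfolding nrm_F by simp
        also have "\<dots> = (2 ^ d) powr (1 / s) * (2 ^ d) powr (real m - 1)"
          using s by (subst powr_mult) (simp only: powr_powr, simp)
        also have "\<dots> = (2 ^ d) powr (real m - 1 + 1 / s)"
          by (simp only: powr_add mult.commute)
        finally show ?thesis by (rule eq_refl[OF sym])
      qed
      have "((2::real) ^ d) powr (real m - 1 + 1 / s + 1 / r) \<le> (C + 1) * (2 ^ d) powr (3 * m / 2)" for d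
      proof -
        have "((2::real) ^ d) powr (real m - 1 + 1 / s + 1 / r) = (2 ^ d) powr (real m - 1 + 1 / s) * (2 ^ d) powr (1 / r)"
          by (rule powr_add)
        also have "\<dots> \<le> (C + 1) * 1 * (2 ^ d) powr (3 * m / 2)"
          by (intro summing_constant_lower_bound[OF assms _ _ upper lower]) auto
        finally show ?thesis by simp
      qed
      then have "real m - 1 + 1 / s + 1 / r \<le> 3 * m / 2" by (rule exponent_le_of_power2_le)
      then have "1 / r \<le> m / 2 + 1 - 1 / s" by simp
      moreover have "m / 2 + 1 - 1 / s = (m * s + 2 * s - 2) / (2 * s)"
        using s by (simp add: field_simps)
      ultimately show ?thesis
        using invert[of "m / 2 + 1 - 1 / s"] True False
        by (simp add: critical_exponent_def s_def[symmetric])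
    next
      case s_gt: False
      \<comment> \<open>Each of the \<open>2 ^ d\<close> coordinates is at most \<open>?M\<close>,
        which costs the factor \<open>(2 ^ d) powr (1 / s)\<close>.\<close>
      have "nrm ?F (?P d x) \<le> (2 ^ d) powr (1 / s) * (\<Prod>q<m. \<Sum>k<2 ^ d. norm (x q k))" (is "_ \<le> _ * ?M") for d x
      proof -
        have M: "0 \<le> ?M" by (intro prod_nonneg sum_nonneg) auto
        have "(\<Sum>k<2 ^ d. norm (?P d x k) powr s) \<le> (\<Sum>k<(2::nat) ^ d. ?M powr s)"
          using s by (intro sum_mono powr_mono2 norm_transform_product_le) auto
        then have "nrm ?F (?P d x) \<le> (2 ^ d * ?M powr s) powr (1 / s)"
          unfolding nrm_F using s by (intro powr_mono2 sum_nonneg) auto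
        also have "\<dots> = (2 ^ d) powr (1 / s) * ?M"
          using s M by (simp add: powr_mult powr_powr)
        finally show ?thesis .
      qed
      then have "1 / r \<le> m / 2 + 1 / s" using s by (intro product_bound) auto
      moreover have "m / 2 + 1 / s = (m * s + 2) / (2 * s)"
        using s by (simp add: field_simps)
      ultimately show ?thesis
        using invert[of "m / 2 + 1 / s"] s_gt False
        by (simp add: critical_exponent_def s_def[symmetric])
    qed
  qed
qed

theorem theorem4p1:
  fixes m :: nat and p :: ennreal and r :: real
  assumes "1 \<le> m" and "1 \<le> p" and "0 < r"
  shows
    "((\<exists>C>0. \<forall>T \<in> multilinear_operators m (lp 1 :: (real, nat \<Rightarrow> real) nspace) (lp p).
         pi_as m r (lp 1) (lp p) T \<le> ennreal (C * op_norm m (lp 1) (lp p) T))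
       \<longrightarrow> critical_exponent m p \<le> r) \<and>
     ((\<exists>C>0. \<forall>T \<in> multilinear_operators m (lp 1 :: (complex, nat \<Rightarrow> complex) nspace) (lp p).
         pi_as m r (lp 1) (lp p) T \<le> ennreal (C * op_norm m (lp 1) (lp p) T))
       \<longrightarrow> critical_exponent m p \<le> r)"
  using critical_exponent_le[OF assms, where 'k = real]
    critical_exponent_le[OF assms, where 'k = complex] by blast

end
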